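(* Let $\kappa$ be an infinite regular cardinal and let $\mathfrak K$ be a $\kappa$-bounded directed category with the amalgamation property. Assume further that $\mathcal F\subseteq\operatorname{Arr}(\mathfrak K)$ is dominating in $\mathfrak K$ and $|\mathcal F|\leq\kappa$. Then there exists a Fraïssé sequence of length $\kappa$ in $\mathfrak K$.
   Context: $\mathfrak K(a,b)$ is the set of arrows from $a$ to $b$, $\operatorname{Arr}(\mathfrak K)$ the class of all arrows. An inductive sequence of length $\delta$ ($\delta>0$ an ordinal) in $\mathfrak K$ is a functor $\vec a\colon\delta\to\mathfrak K$: objects $a_\xi$ ($\xi<\delta$) and arrows $a_\xi^\eta\colon a_\xi\to a_\eta$ ($\xi\leq\eta<\delta$) with $a_\xi^\xi=\mathrm{id}$ and $a_\eta^\rho\circ a_\xi^\eta=a_\xi^\rho$. $\mathfrak K$ is $\kappa$-bounded if for every inductive sequence $\vec x$ of length $\lambda<\kappa$ there are an object $y$ and arrows $y_\alpha\colon x_\alpha\to y$ ($\alpha<\lambda$) with $y_\beta\circ x_\alpha^\beta=y_\alpha$ for $\alpha<\beta<\lambda$. $\mathfrak K$ is directed if for all objects $a,b$ there is an object $g$ with $\mathfrak K(a,g)\neq\emptyset\neq\mathfrak K(b,g)$. $\mathfrak K$ has the amalgamation property if for all arrows $f\colon a\to b$, $g\colon a\to c$ there are $d$ and arrows $f'\colon b\to d$, $g'\colon c\to d$ with $f'\circ f=g'\circ g$. Let $\operatorname{Dom}(\mathcal F)=\{\operatorname{dom}(f): f\in\mathcal F\}$. $\mathcal F$ is dominating in $\mathfrak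 K$ if (D1) for every object $x$ there is $a\in\operatorname{Dom}(\mathcal F)$ with $\mathfrak K(x,a)\neq\emptyset$; (D2) for every $a\in\operatorname{Dom}(\mathcal F)$ and every arrow $f\colon a\to y$ in $\mathfrak K$ there is an arrow $g\colon y\to b$ in $\mathfrak K$ with $g\circ f\in\mathcal F$. A Fraïssé sequence of length $\kappa$ in $\mathfrak K$ is an inductive sequence $\vec u$ of length $\kappa$ such that (U) for every object $x$ there is $\xi<\kappa$ with $\mathfrak K(x,u_\xi)\neq\emptyset$; (A) for every $\xi<\kappa$ and every arrow $f\colon u_\xi\to y$ there are $\eta\geq\xi$, $\eta<\kappa$, and $g\colon y\to u_\eta$ with $u_\xi^\eta=g\circ f$. *)

theory Defs
  imports Main
begin

unbundle cardinal_syntax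

record ('o, 'm) cat =
  Obj :: "'o set"
  Arr :: "'m set"
  source :: "'m \<Rightarrow> 'o"
  target :: "'m \<Rightarrow> 'o"
  ident :: "'o \<Rightarrow> 'm"
  compose :: "'m \<Rightarrow> 'm \<Rightarrow> 'm" (infixr \<open>\<cdot>\<index>\<close> 55)

definition hom :: "('o, 'm) cat \<Rightarrow> 'o \<Rightarrow> 'o \<Rightarrow> 'm set" where
  "hom K a b = {f \<in> Arr K. source K f = a \<and> target K f = b}"

text \<open>Composition is written as for functions: \<open>g \<cdot>\<^bsub>K\<^esub> f\<close> is \<open>f\<close> followed by \<open>g\<close>.\<close>

locale category =
  fixes K :: "('o, 'm) cat" (structure)
  assumes source_in_Obj: "f \<in> Arr K \<Longrightarrow> source K f \<in> Obj K"
    and target_in_Obj: "f \<in> Arr K \<Longrightarrow> target K f \<in> Obj K"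
    and ident_in_hom: "a \<in> Obj K \<Longrightarrow> ident K a \<in> hom K a a"
    and compose_in_hom: "\<lbrakk>f \<in> hom K a b; g \<in> hom K b c\<rbrakk> \<Longrightarrow> g \<cdot> f \<in> hom K a c"
    and compose_ident: "f \<in> hom K a b \<Longrightarrow> f \<cdot> ident K a = f"
    and ident_compose: "f \<in> hom K a b \<Longrightarrow> ident K b \<cdot> f = f"
    and compose_assoc:
      "\<lbrakk>f \<in> hom K a b; g \<in> hom K b c; h \<in> hom K c d\<rbrakk> \<Longrightarrow> (h \<cdot> g) \<cdot> f = h \<cdot> (g \<cdot> f)"

text \<open>
  Ordinals are represented by well-order relations: the ordinals below the length are the
  elements of the field, and \<open>(\<xi>, \<eta>) \<in> \<delta>\<close> means \<open>\<xi> \<le> \<eta>\<close>. The sequence consists of the objects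
  \<open>x \<xi>\<close> and the arrows \<open>t \<xi> \<eta> : x \<xi> \<rightarrow> x \<eta>\<close> for \<open>\<xi> \<le> \<eta>\<close>.
\<close>

definition inductive_sequence ::
  "('o, 'm) cat \<Rightarrow> 'i rel \<Rightarrow> ('i \<Rightarrow> 'o) \<Rightarrow> ('i \<Rightarrow> 'i \<Rightarrow> 'm) \<Rightarrow> bool" where
  "inductive_sequence K \<delta> x t \<longleftrightarrow>
     Well_order \<delta> \<and> Field \<delta> \<noteq> {} \<and>
     (\<forall>\<xi>\<in>Field \<delta>. x \<xi> \<in> Obj K) \<and>
     (\<forall>\<xi> \<eta>. (\<xi>, \<eta>) \<in> \<delta> \<longrightarrow> t \<xi> \<eta> \<in> hom K (x \<xi>) (x \<eta>)) \<and>
     (\<forall>\<xi>\<in>Field \<delta>. t \<xi> \<xi> = ident K (x \<xi>)) \<and>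
     (\<forall>\<xi> \<eta> \<rho>. (\<xi>, \<eta>) \<in> \<delta> \<and> (\<eta>, \<rho>) \<in> \<delta> \<longrightarrow> t \<eta> \<rho> \<cdot>\<^bsub>K\<^esub> t \<xi> \<eta> = t \<xi> \<rho>)"

text \<open>
  Every ordinal below \<open>\<kappa>\<close> is the order type of a proper initial segment of \<open>\<kappa>\<close>, so it
  suffices to consider lengths \<open>\<mu>\<close> on the same type as \<open>\<kappa>\<close>.
\<close>

definition bounded_category :: "('o, 'm) cat \<Rightarrow> 'k rel \<Rightarrow> bool" where
  "bounded_category K \<kappa> \<longleftrightarrow>
     (\<forall>(\<mu> :: 'k rel) x t. \<mu> <o \<kappa> \<and> inductive_sequence K \<mu> x t \<longrightarrow>
        (\<exists>y\<in>Obj K. \<exists>s. (\<forall>\<alpha>\<in>Field \<mu>. s \<alpha> \<in> hom K (x \<alpha>) y) \<and>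
           (\<forall>\<alpha> \<beta>. (\<alpha>, \<beta>) \<in> \<mu> \<and> \<alpha> \<noteq> \<beta> \<longrightarrow> s \<beta> \<cdot>\<^bsub>K\<^esub> t \<alpha> \<beta> = s \<alpha>)))"

definition directed_category :: "('o, 'm) cat \<Rightarrow> bool" where
  "directed_category K \<longleftrightarrow>
     (\<forall>a\<in>Obj K. \<forall>b\<in>Obj K. \<exists>g\<in>Obj K. hom K a g \<noteq> {} \<and> hom K b g \<noteq> {})"

definition amalgamation_property :: "('o, 'm) cat \<Rightarrow> bool" where
  "amalgamation_property K \<longleftrightarrow>
     (\<forall>a\<in>Obj K. \<forall>b\<in>Obj K. \<forall>c\<in>Obj K. \<forall>f\<in>hom K a b. \<forall>g\<in>hom K a c.
        \<exists>d\<in>Obj K. \<exists>f'\<in>hom K b d. \<exists>g'\<in>hom K c d. f' \<cdot>\<^bsub>K\<^esub> f = g' \<cdot>\<^bsub>K\<^esub> g)"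

definition Dom :: "('o, 'm) cat \<Rightarrow> 'm set \<Rightarrow> 'o set" where
  "Dom K F = source K ` F"

definition dominating :: "('o, 'm) cat \<Rightarrow> 'm set \<Rightarrow> bool" where
  "dominating K F \<longleftrightarrow>
     (\<forall>x\<in>Obj K. \<exists>a\<in>Dom K F. hom K x a \<noteq> {}) \<and>
     (\<forall>a\<in>Dom K F. \<forall>y\<in>Obj K. \<forall>f\<in>hom K a y. \<exists>b\<in>Obj K. \<exists>g\<in>hom K y b. g \<cdot>\<^bsub>K\<^esub> f \<in> F)"

definition fraisse_sequence ::
  "('o, 'm) cat \<Rightarrow> 'k rel \<Rightarrow> ('k \<Rightarrow> 'o) \<Rightarrow> ('k \<Rightarrow> 'k \<Rightarrow> 'm) \<Rightarrow> bool" where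
  "fraisse_sequence K \<kappa> u t \<longleftrightarrow>
     inductive_sequence K \<kappa> u t \<and>
     (\<forall>x\<in>Obj K. \<exists>\<xi>\<in>Field \<kappa>. hom K x (u \<xi>) \<noteq> {}) \<and>
     (\<forall>\<xi>\<in>Field \<kappa>. \<forall>y\<in>Obj K. \<forall>f\<in>hom K (u \<xi>) y.
        \<exists>\<eta>. (\<xi>, \<eta>) \<in> \<kappa> \<and> (\<exists>g\<in>hom K y (u \<eta>). t \<xi> \<eta> = g \<cdot>\<^bsub>K\<^esub> f))"

end

theory Submission
  imports Defs
begin

text \<open>
  The sequence is built by recursion along \<open>\<kappa>\<close>, with all its objects in \<open>Dom K F\<close>. At a stage \<open>\<beta>\<close>
  the part constructed so far is an inductive sequence of length less than \<open>\<kappa>\<close>, so boundedness gives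
  a cocone over it, and any arrow out of the vertex of that cocone extends it. This freedom is used
  twice: (D1) moves the vertex back into \<open>Dom K F\<close>, and amalgamation absorbs one prescribed arrow
  \<open>f \<in> F\<close> that starts at an earlier object \<open>u \<xi>\<close>, so that the transition from \<open>u \<xi>\<close> to the new object
  \<open>u \<beta>\<close> factors through \<open>f\<close> (lemma \<open>cocone_absorbing_arrow\<close>).

  There are at most \<open>\<kappa>\<close> pairs \<open>(\<xi>, f)\<close>, so the stages can be enumerated such that each pair is
  treated at some stage after \<open>\<xi>\<close> (lemma \<open>bookkeeping\<close>). This yields (A): given \<open>f: u \<xi> \<rightarrow> y\<close>, (D2)
  provides \<open>g\<close> with \<open>g \<cdot> f \<in> F\<close>, and a transition that factors through \<open>g \<cdot> f\<close> factors through \<open>f\<close>.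

  Property (U) needs no stages of its own. For an object \<open>x\<close>, directedness gives arrows from \<open>x\<close> and
  from some \<open>u \<xi>\<close> to a common object, and (A), applied to the latter, leads from there back into
  the sequence.
\<close>

section \<open>Cocones\<close>

definition cocone ::
  "('o, 'm) cat \<Rightarrow> 'i rel \<Rightarrow> ('i \<Rightarrow> 'o) \<Rightarrow> ('i \<Rightarrow> 'i \<Rightarrow> 'm) \<Rightarrow> 'o \<Rightarrow> ('i \<Rightarrow> 'm) \<Rightarrow> bool" where
  "cocone K \<delta> x t y s \<longleftrightarrow>
     y \<in> Obj K \<and> (\<forall>\<alpha>\<in>Field \<delta>. s \<alpha> \<in> hom K (x \<alpha>) y) \<and>
     (\<forall>\<alpha> \<beta>. (\<alpha>, \<beta>) \<in> \<delta> \<and> \<alpha> \<noteq> \<beta> \<longrightarrow> s \<beta> \<cdot>\<^bsub>K\<^esub> t \<alpha> \<beta> = s \<alpha>)"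

lemma cocone_cong:
  assumes "\<And>\<alpha>. \<alpha> \<in> Field \<delta> \<Longrightarrow> x \<alpha> = x' \<alpha>"
    and "\<And>\<alpha> \<beta>. (\<alpha>, \<beta>) \<in> \<delta> \<Longrightarrow> t \<alpha> \<beta> = t' \<alpha> \<beta>"
  shows "cocone K \<delta> x t y s \<longleftrightarrow> cocone K \<delta> x' t' y s"
  unfolding cocone_def using assms by auto

lemma bounded_category_imp_cocone:
  fixes \<kappa> \<mu> :: "'k rel"
  assumes "bounded_category K \<kappa>" and "\<mu> <o \<kappa>" and "inductive_sequence K \<mu> x t"
  shows "\<exists>y s. cocone K \<mu> x t y s"
  using assms(1)[unfolded bounded_category_def, rule_format, OF conjI, OF assms(2,3)]
  unfolding cocone_def by blast

context category
begin

lemma hom_imp_Obj: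
  assumes "f \<in> hom K a b"
  shows "a \<in> Obj K" "b \<in> Obj K"
  using assms source_in_Obj target_in_Obj by (auto simp: hom_def)

lemma cocone_postcompose:
  assumes "inductive_sequence K \<delta> x t" and "cocone K \<delta> x t y s" and k: "k \<in> hom K y z"
  shows "cocone K \<delta> x t z (\<lambda>\<alpha>. k \<cdot> s \<alpha>)"
proof -
  have "(k \<cdot> s \<beta>) \<cdot> t \<alpha> \<beta> = k \<cdot> s \<alpha>" if "(\<alpha>, \<beta>) \<in> \<delta>" "\<alpha> \<noteq> \<beta>" for \<alpha> \<beta>
  proof -
    have "t \<alpha> \<beta> \<in> hom K (x \<alpha>) (x \<beta>)"
      using assms(1) that by (auto simp: inductive_sequence_def)
    moreover have "s \<beta> \<in> hom K (x \<beta>) y"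
      using assms(2) that by (auto simp: cocone_def intro: FieldI2)
    ultimately have "(k \<cdot> s \<beta>) \<cdot> t \<alpha> \<beta> = k \<cdot> (s \<beta> \<cdot> t \<alpha> \<beta>)"
      using k compose_assoc by blast
    then show ?thesis using assms(2) that by (simp add: cocone_def)
  qed
  then show ?thesis
    using assms(2) k compose_in_hom hom_imp_Obj by (fastforce simp: cocone_def)
qed

lemma cocone_into_Dom:
  assumes "inductive_sequence K \<delta> x t" and "cocone K \<delta> x t y s" and "dominating K F"
  obtains u k where "u \<in> Dom K F" "k \<in> hom K y u" "cocone K \<delta> x t u (\<lambda>\<alpha>. k \<cdot> s \<alpha>)"
proof -
  from assms(2) have "y \<in> Obj K" by (simp add: cocone_def)
  with assms(3) obtain u k where "u \<in> Dom K F" "k \<in> hom K y u"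
    unfolding dominating_def by blast
  with that cocone_postcompose[OF assms(1,2)] show thesis by blast
qed

text \<open>
  Amalgamating \<open>f\<close> with the leg of the given cocone at \<open>\<xi>\<close> makes the new leg at \<open>\<xi>\<close> factor through
  \<open>f\<close>; moving the vertex into \<open>Dom K F\<close> afterwards preserves the factorization.
\<close>

lemma cocone_absorbing_arrow:
  assumes seq: "inductive_sequence K \<delta> x t" and coc: "cocone K \<delta> x t y s"
    and amalg: "amalgamation_property K" and dom: "dominating K F"
    and \<xi>: "\<xi> \<in> Field \<delta>" and f: "f \<in> hom K (x \<xi>) z"
  obtains u s' h where "u \<in> Dom K F" "cocone K \<delta> x t u s'" "h \<in> hom K z u" "s' \<xi> = h \<cdot> f"
proof -
  have s\<xi>: "s \<xi> \<in> hom K (x \<xi>) y" using coc \<xi> by (simp add: cocone_def)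
  obtain d f' g' where f': "f' \<in> hom K z d" and g': "g' \<in> hom K y d"
    and eq: "f' \<cdot> f = g' \<cdot> s \<xi>"
    using amalg hom_imp_Obj[OF f] hom_imp_Obj[OF s\<xi>] f s\<xi>
    unfolding amalgamation_property_def by metis
  obtain u k where u: "u \<in> Dom K F" and k: "k \<in> hom K d u"
    and coc': "cocone K \<delta> x t u (\<lambda>\<alpha>. k \<cdot> (g' \<cdot> s \<alpha>))"
    using cocone_into_Dom[OF seq cocone_postcompose[OF seq coc g'] dom] by metis
  have "k \<cdot> (g' \<cdot> s \<xi>) = (k \<cdot> f') \<cdot> f"
    using compose_assoc[OF f f' k] eq by simp
  with that[OF u coc' compose_in_hom[OF f' k]] show thesis by simp
qed

end

section \<open>Stages of the recursion\<close>

text \<open>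
  The value of the recursion at \<open>\<beta>\<close> is a pair: the object \<open>u \<beta>\<close>, and the arrows into it from the
  objects with smaller index. The identities at \<open>\<beta>\<close> itself are supplied here.
\<close>

definition transition ::
  "('o, 'm) cat \<Rightarrow> ('k \<Rightarrow> 'o \<times> ('k \<Rightarrow> 'm)) \<Rightarrow> 'k \<Rightarrow> 'k \<Rightarrow> 'm" where
  "transition K G \<alpha> \<beta> = (if \<alpha> = \<beta> then ident K (fst (G \<alpha>)) else snd (G \<beta>) \<alpha>)"

definition absorbs ::
  "('o, 'm) cat \<Rightarrow> 'm \<Rightarrow> 'o \<Rightarrow> 'm \<Rightarrow> bool" where
  "absorbs K f u e \<longleftrightarrow> (\<exists>h\<in>hom K (target K f) u. e = h \<cdot>\<^bsub>K\<^esub> f)"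

text \<open>
  \<open>\<phi> \<beta>\<close> is the pair \<open>(\<xi>, f)\<close> to be treated at stage \<open>\<beta>\<close>. It is ignored when \<open>\<xi>\<close> is not smaller than
  \<open>\<beta>\<close> or \<open>f\<close> does not start at \<open>u \<xi>\<close>, since \<open>\<phi>\<close> is chosen before the sequence is known.
\<close>

definition valid_stage ::
  "('o, 'm) cat \<Rightarrow> 'm set \<Rightarrow> 'k rel \<Rightarrow> ('k \<Rightarrow> 'k \<times> 'm) \<Rightarrow>
    ('k \<Rightarrow> 'o \<times> ('k \<Rightarrow> 'm)) \<Rightarrow> 'k \<Rightarrow> 'o \<times> ('k \<Rightarrow> 'm) \<Rightarrow> bool" where
  "valid_stage K F \<kappa> \<phi> G \<beta> r \<longleftrightarrow>
     fst r \<in> Dom K F \<and>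
     cocone K (Restr \<kappa> (underS \<kappa> \<beta>)) (fst \<circ> G) (transition K G) (fst r) (snd r) \<and>
     (\<forall>\<xi> f. \<phi> \<beta> = (\<xi>, f) \<and> \<xi> \<in> underS \<kappa> \<beta> \<and> f \<in> F \<and> source K f = fst (G \<xi>) \<longrightarrow>
        absorbs K f (fst r) (snd r \<xi>))"

lemma valid_stage_cong:
  assumes "\<And>\<alpha>. \<alpha> \<in> underS \<kappa> \<beta> \<Longrightarrow> G \<alpha> = G' \<alpha>"
  shows "valid_stage K F \<kappa> \<phi> G \<beta> r \<longleftrightarrow> valid_stage K F \<kappa> \<phi> G' \<beta> r"
proof -
  have "cocone K (Restr \<kappa> (underS \<kappa> \<beta>)) (fst \<circ> G) (transition K G) (fst r) (snd r) \<longleftrightarrow>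
      cocone K (Restr \<kappa> (underS \<kappa> \<beta>)) (fst \<circ> G') (transition K G') (fst r) (snd r)"
    by (rule cocone_cong) (auto simp: Field_def transition_def assms)
  then show ?thesis unfolding valid_stage_def using assms by auto
qed

lemma Field_Restr_Well_order:
  assumes "Well_order r" and "A \<subseteq> Field r"
  shows "Field (Restr r A) = A"
  using assms by (intro Refl_Field_Restr2) (auto simp: order_on_defs)

text \<open>
  The laws of an inductive sequence are exactly the cocone conditions of its stages, together with
  the identity laws. The set \<open>A\<close> is an initial segment during the recursion and the whole field
  at the end.
\<close>

lemma (in category) inductive_sequence_of_stages:
  assumes wo: "Well_order \<kappa>" and A: "A \<noteq> {}" "A \<subseteq> Field \<kappa>"
    and stages: "\<And>\<beta>. \<beta> \<in> A \<Longrightarrow> valid_stage K F \<kappa> \<phi> G \<beta> (G \<beta>)"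
  shows "inductive_sequence K (Restr \<kappa> A) (fst \<circ> G) (transition K G)"
proof -
  have coc: "cocone K (Restr \<kappa> (underS \<kappa> \<beta>)) (fst \<circ> G) (transition K G) (fst (G \<beta>)) (snd (G \<beta>))"
    if "\<beta> \<in> A" for \<beta>
    using stages[OF that] by (simp add: valid_stage_def)
  have obj: "fst (G \<beta>) \<in> Obj K" if "\<beta> \<in> A" for \<beta>
    using coc[OF that] by (simp add: cocone_def)
  have antisym: "antisym \<kappa>" and trans: "trans \<kappa>" and refl: "Refl \<kappa>"
    using wo by (auto simp: order_on_defs)
  have field: "Field (Restr \<kappa> (underS \<kappa> \<beta>)) = underS \<kappa> \<beta>" for \<beta>
    by (rule Field_Restr_Well_order[OF wo]) (auto simp: underS_def Field_def)
  have arr: "transition K G \<alpha> \<beta> \<in> hom K (fst (G \<alpha>)) (fst (G \<beta>))"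
    if "\<alpha> \<in> A" "\<beta> \<in> A" "(\<alpha>, \<beta>) \<in> \<kappa>" for \<alpha> \<beta>
  proof (cases "\<alpha> = \<beta>")
    case True
    then show ?thesis using ident_in_hom obj that by (simp add: transition_def)
  next
    case False
    then have "\<alpha> \<in> underS \<kappa> \<beta>" using that by (simp add: underS_def)
    then have "snd (G \<beta>) \<alpha> \<in> hom K (fst (G \<alpha>)) (fst (G \<beta>))"
      using coc[OF that(2)] field by (simp add: cocone_def)
    then show ?thesis using False by (simp add: transition_def)
  qed
  have comp: "transition K G \<beta> \<gamma> \<cdot> transition K G \<alpha> \<beta> = transition K G \<alpha> \<gamma>"
    if "\<alpha> \<in> A" "\<beta> \<in> A" "\<gamma> \<in> A" "(\<alpha>, \<beta>) \<in> \<kappa>" "(\<beta>, \<gamma>) \<in> \<kappa>" for \<alpha> \<beta> \<gamma>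
  proof (cases "\<alpha> = \<beta> \<or> \<beta> = \<gamma>")
    case True
    then show ?thesis
      using compose_ident[OF arr] ident_compose[OF arr] that
      by (metis transition_def)
  next
    case False
    then have "\<alpha> \<noteq> \<gamma>" "(\<alpha>, \<gamma>) \<in> \<kappa>"
      using that antisym trans by (auto dest: antisymD transD)
    then have "(\<alpha>, \<beta>) \<in> Restr \<kappa> (underS \<kappa> \<gamma>)"
      using False that by (simp add: underS_def)
    then have "snd (G \<gamma>) \<beta> \<cdot> transition K G \<alpha> \<beta> = snd (G \<gamma>) \<alpha>"
      using coc[OF that(3)] False by (simp add: cocone_def)
    then show ?thesis using False \<open>\<alpha> \<noteq> \<gamma>\<close> by (simp add: transition_def)
  qed
  show ?thesis
    unfolding inductive_sequence_def Field_Restr_Well_order[OF wo A(2)]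
    using well_order_on_Restr[OF wo A(2)] A(1) obj arr comp
    by (auto simp: transition_def)
qed

lemma (in category) valid_stage_exists:
  assumes wo: "Well_order \<kappa>" and \<beta>: "\<beta> \<in> Field \<kappa>"
    and obj: "Obj K \<noteq> {}" and bounded: "bounded_category K \<kappa>"
    and amalg: "amalgamation_property K" and F: "F \<subseteq> Arr K" and dom: "dominating K F"
    and stages: "\<And>\<alpha>. \<alpha> \<in> underS \<kappa> \<beta> \<Longrightarrow> valid_stage K F \<kappa> \<phi> G \<alpha> (G \<alpha>)"
  shows "\<exists>r. valid_stage K F \<kappa> \<phi> G \<beta> r"
proof (cases "underS \<kappa> \<beta> = {}")
  case True
  from obj dom obtain a where "a \<in> Dom K F" unfolding dominating_def by blast
  moreover from this F have "a \<in> Obj K" using source_in_Obj by (auto simp: Dom_def)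
  ultimately have "valid_stage K F \<kappa> \<phi> G \<beta> (a, undefined)"
    using True by (simp add: valid_stage_def cocone_def)
  then show ?thesis ..
next
  case False
  let ?\<delta> = "Restr \<kappa> (underS \<kappa> \<beta>)" and ?x = "fst \<circ> G" and ?t = "transition K G"
  have sub: "underS \<kappa> \<beta> \<subseteq> Field \<kappa>" by (auto simp: underS_def Field_def)
  have seq: "inductive_sequence K ?\<delta> ?x ?t"
    using inductive_sequence_of_stages[OF wo False sub] stages by blast
  have short: "?\<delta> <o \<kappa>" using underS_Restr_ordLess[OF wo] \<beta> by blast
  obtain y s where coc: "cocone K ?\<delta> ?x ?t y s"
    using bounded_category_imp_cocone[OF bounded short seq] by blast
  obtain \<xi> f where \<phi>: "\<phi> \<beta> = (\<xi>, f)" by fastforce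
  show ?thesis
  proof (cases "\<xi> \<in> underS \<kappa> \<beta> \<and> f \<in> F \<and> source K f = fst (G \<xi>)")
    case True
    then have "\<xi> \<in> Field ?\<delta>" using Field_Restr_Well_order[OF wo sub] by simp
    moreover have "f \<in> hom K (?x \<xi>) (target K f)" using True F by (auto simp: hom_def)
    ultimately obtain u s' h where "u \<in> Dom K F" "cocone K ?\<delta> ?x ?t u s'"
      "h \<in> hom K (target K f) u" "s' \<xi> = h \<cdot> f"
      using cocone_absorbing_arrow[OF seq coc amalg dom] by blast
    then have "valid_stage K F \<kappa> \<phi> G \<beta> (u, s')"
      using \<phi> by (auto simp: valid_stage_def absorbs_def)
    then show ?thesis ..
  next
    case False
    obtain u k where "u \<in> Dom K F" "cocone K ?\<delta> ?x ?t u (\<lambda>\<alpha>. k \<cdot> s \<alpha>)"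
      using cocone_into_Dom[OF seq coc dom] by blast
    then have "valid_stage K F \<kappa> \<phi> G \<beta> (u, \<lambda>\<alpha>. k \<cdot> s \<alpha>)"
      using \<phi> False by (auto simp: valid_stage_def)
    then show ?thesis ..
  qed
qed

section \<open>Bookkeeping\<close>

text \<open>
  Enumerate \<open>(Field \<kappa> \<times> F) \<times> Field \<kappa>\<close>, which has at most \<open>\<kappa>\<close> elements, and forget the last
  component. Then every pair is listed \<open>\<kappa>\<close> many times, hence not only at places below a given one,
  of which there are fewer than \<open>\<kappa>\<close>.
\<close>

lemma bookkeeping:
  assumes card: "Card_order \<kappa>" and inf: "cinfinite \<kappa>" and F: "|F| \<le>o \<kappa>"
  obtains \<phi> where "\<And>\<xi> f. \<xi> \<in> Field \<kappa> \<Longrightarrow> f \<in> F \<Longrightarrow> \<exists>\<beta>. \<xi> \<in> underS \<kappa> \<beta> \<and> \<phi> \<beta> = (\<xi>, f)"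
proof -
  let ?A = "(Field \<kappa> \<times> F) \<times> Field \<kappa>"
  have inf': "\<not> finite (Field \<kappa>)" using inf by (simp add: cinfinite_def)
  have field: "|Field \<kappa>| \<le>o \<kappa>"
    using card_of_Field_ordIso[OF card] by (rule ordIso_imp_ordLeq)
  have "|?A| \<le>o \<kappa>"
    by (intro card_of_Times_ordLeq_infinite_Field inf' field F card)
  then have "|?A| \<le>o |Field \<kappa>|"
    using card_of_Field_ordIso[OF card] ordLeq_ordIso_trans ordIso_symmetric by blast
  then obtain i where inj: "inj_on i ?A" and range: "i ` ?A \<subseteq> Field \<kappa>"
    using card_of_ordLeq[of ?A "Field \<kappa>"] by blast
  have wo: "Well_order \<kappa>" using card by (simp add: card_order_on_def)
  have "\<exists>\<beta>. \<xi> \<in> underS \<kappa> \<beta> \<and> fst (inv_into ?A i \<beta>) = (\<xi>, f)"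
    if \<xi>: "\<xi> \<in> Field \<kappa>" and f: "f \<in> F" for \<xi> f
  proof -
    obtain b where b: "b \<in> Field \<kappa>" "\<xi> \<noteq> b" "(\<xi>, b) \<in> \<kappa>"
      using infinite_Card_order_limit[OF card inf' \<xi>] by blast
    define j where "j = (\<lambda>\<zeta>. i ((\<xi>, f), \<zeta>))"
    have inj_j: "inj_on j (Field \<kappa>)"
      using inj \<xi> f by (auto simp: inj_on_def j_def)
    have "\<not> j ` Field \<kappa> \<subseteq> underS \<kappa> b"
    proof
      assume "j ` Field \<kappa> \<subseteq> underS \<kappa> b"
      then have "|Field \<kappa>| \<le>o |underS \<kappa> b|"
        using inj_j card_of_ordLeq[of "Field \<kappa>" "underS \<kappa> b"] by blast
      then have "\<kappa> \<le>o |underS \<kappa> b|"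
        using card_of_Field_ordIso[OF card] ordIso_ordLeq_trans ordIso_symmetric by blast
      with card_of_underS[OF card b(1)] show False using not_ordLess_ordLeq by blast
    qed
    then obtain \<zeta> where \<zeta>: "\<zeta> \<in> Field \<kappa>" "j \<zeta> \<notin> underS \<kappa> b" by blast
    have "j \<zeta> \<in> Field \<kappa>" using range \<xi> f \<zeta> by (auto simp: j_def)
    then have "(b, j \<zeta>) \<in> \<kappa>"
      using wo b(1) \<zeta>(2) by (fastforce simp: order_on_defs total_on_def refl_on_def underS_def)
    then have "\<xi> \<in> underS \<kappa> (j \<zeta>)"
      using wo b by (auto simp: underS_def order_on_defs dest: antisymD transD)
    moreover have "inv_into ?A i (j \<zeta>) = ((\<xi>, f), \<zeta>)"
      unfolding j_def using inj \<xi> f \<zeta>(1) by (intro inv_into_f_f) auto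
    ultimately show ?thesis by auto
  qed
  with that[of "\<lambda>\<beta>. fst (inv_into ?A i \<beta>)"] show thesis by blast
qed

section \<open>Existence of the sequence\<close>

theorem theorem3p7:
  fixes K :: "('o, 'm) cat" and \<kappa> :: "'k rel" and F :: "'m set"
  assumes "Card_order \<kappa>" and "cinfinite \<kappa>" and "regularCard \<kappa>"
    and "category K" and "Obj K \<noteq> {}"
    and "bounded_category K \<kappa>"
    and "directed_category K"
    and "amalgamation_property K"
    and "F \<subseteq> Arr K" and "dominating K F" and "|F| \<le>o \<kappa>"
  shows "\<exists>u t. fraisse_sequence K \<kappa> u t"
proof -
  interpret category K by fact
  have wo: "Well_order \<kappa>" using \<open>Card_order \<kappa>\<close> by (simp add: card_order_on_def)
  have nonempty: "Field \<kappa> \<noteq> {}" using \<open>cinfinite \<kappa>\<close> by (auto simp: cinfinite_def)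
  obtain \<phi> where \<phi>: "\<And>\<xi> f. \<xi> \<in> Field \<kappa> \<Longrightarrow> f \<in> F \<Longrightarrow> \<exists>\<beta>. \<xi> \<in> underS \<kappa> \<beta> \<and> \<phi> \<beta> = (\<xi>, f)"
    using bookkeeping[OF \<open>Card_order \<kappa>\<close> \<open>cinfinite \<kappa>\<close> \<open>|F| \<le>o \<kappa>\<close>] by blast
  have "\<exists>G. \<forall>\<beta>. \<beta> \<in> Field \<kappa> \<longrightarrow> valid_stage K F \<kappa> \<phi> G \<beta> (G \<beta>)"
  proof (rule dependent_wf_choice[where R = "\<kappa> - Id"])
    show "wf (\<kappa> - Id)" using wo by (simp add: well_order_on_def)
  next
    fix G G' :: "'k \<Rightarrow> 'o \<times> ('k \<Rightarrow> 'm)" and \<beta> r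
    assume "\<And>\<alpha>. (\<alpha>, \<beta>) \<in> \<kappa> - Id \<Longrightarrow> G \<alpha> = G' \<alpha>"
    then have "valid_stage K F \<kappa> \<phi> G \<beta> r \<longleftrightarrow> valid_stage K F \<kappa> \<phi> G' \<beta> r"
      by (intro valid_stage_cong) (auto simp: underS_def)
    then show "(\<beta> \<in> Field \<kappa> \<longrightarrow> valid_stage K F \<kappa> \<phi> G \<beta> r) =
        (\<beta> \<in> Field \<kappa> \<longrightarrow> valid_stage K F \<kappa> \<phi> G' \<beta> r)" by simp
  next
    fix \<beta> and G :: "'k \<Rightarrow> 'o \<times> ('k \<Rightarrow> 'm)"
    assume prev: "\<And>\<alpha>. (\<alpha>, \<beta>) \<in> \<kappa> - Id \<Longrightarrow>
      \<alpha> \<in> Field \<kappa> \<longrightarrow> valid_stage K F \<kappa> \<phi> G \<alpha> (G \<alpha>)"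
    have "valid_stage K F \<kappa> \<phi> G \<alpha> (G \<alpha>)" if "\<alpha> \<in> underS \<kappa> \<beta>" for \<alpha>
      using prev[of \<alpha>] that by (auto simp: underS_def intro: FieldI1)
    then show "\<exists>r. \<beta> \<in> Field \<kappa> \<longrightarrow> valid_stage K F \<kappa> \<phi> G \<beta> r"
      using valid_stage_exists[OF wo] assms(5,6,8-10) by blast
  qed
  then obtain G where stages: "\<And>\<beta>. \<beta> \<in> Field \<kappa> \<Longrightarrow> valid_stage K F \<kappa> \<phi> G \<beta> (G \<beta>)"
    by blast
  let ?u = "fst \<circ> G" and ?t = "transition K G"
  have "inductive_sequence K (Restr \<kappa> (Field \<kappa>)) ?u ?t"
    using inductive_sequence_of_stages[OF wo nonempty subset_refl] stages by blast
  then have seq: "inductive_sequence K \<kappa> ?u ?t" by (simp add: Restr_Field)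
  have A: "\<exists>\<eta>. (\<xi>, \<eta>) \<in> \<kappa> \<and> (\<exists>g\<in>hom K y (?u \<eta>). ?t \<xi> \<eta> = g \<cdot>\<^bsub>K\<^esub> f)"
    if \<xi>: "\<xi> \<in> Field \<kappa>" and f: "f \<in> hom K (?u \<xi>) y" for \<xi> y f
  proof -
    have "?u \<xi> \<in> Dom K F" using stages[OF \<xi>] by (simp add: valid_stage_def)
    then obtain b g where g: "g \<in> hom K y b" and gf: "g \<cdot>\<^bsub>K\<^esub> f \<in> F"
      using \<open>dominating K F\<close> f hom_imp_Obj[OF f] unfolding dominating_def by blast
    have ends: "source K (g \<cdot>\<^bsub>K\<^esub> f) = ?u \<xi>" "target K (g \<cdot>\<^bsub>K\<^esub> f) = b"
      using compose_in_hom[OF f g] by (auto simp: hom_def)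
    obtain \<eta> where \<eta>: "\<xi> \<in> underS \<kappa> \<eta>" "\<phi> \<eta> = (\<xi>, g \<cdot>\<^bsub>K\<^esub> f)" using \<phi>[OF \<xi> gf] by blast
    then have less: "(\<xi>, \<eta>) \<in> \<kappa>" "\<xi> \<noteq> \<eta>" by (auto simp: underS_def)
    have "absorbs K (g \<cdot>\<^bsub>K\<^esub> f) (?u \<eta>) (snd (G \<eta>) \<xi>)"
      using stages[OF FieldI2[OF less(1)]] \<eta> gf ends by (simp add: valid_stage_def)
    then obtain h where h: "h \<in> hom K b (?u \<eta>)" and "?t \<xi> \<eta> = h \<cdot>\<^bsub>K\<^esub> (g \<cdot>\<^bsub>K\<^esub> f)"
      using ends less(2) by (auto simp: absorbs_def transition_def)
    then have "?t \<xi> \<eta> = (h \<cdot>\<^bsub>K\<^esub> g) \<cdot>\<^bsub>K\<^esub> f" using compose_assoc[OF f g h] by simp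
    then show ?thesis using less(1) compose_in_hom[OF g h] by blast
  qed
  have "\<exists>\<xi>\<in>Field \<kappa>. hom K x (?u \<xi>) \<noteq> {}" if x: "x \<in> Obj K" for x
  proof -
    from nonempty obtain \<xi> where \<xi>: "\<xi> \<in> Field \<kappa>" by blast
    then have "?u \<xi> \<in> Obj K" using seq by (simp add: inductive_sequence_def)
    then obtain c p q where p: "p \<in> hom K x c" and q: "q \<in> hom K (?u \<xi>) c"
      using \<open>directed_category K\<close> x unfolding directed_category_def by blast
    obtain \<eta> g where \<eta>: "(\<xi>, \<eta>) \<in> \<kappa>" and g: "g \<in> hom K c (?u \<eta>)" using A[OF \<xi> q] by blast
    have "g \<cdot>\<^bsub>K\<^esub> p \<in> hom K x (?u \<eta>)" using compose_in_hom[OF p g] .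
    then show ?thesis using FieldI2[OF \<eta>] by blast
  qed
  with seq A have "fraisse_sequence K \<kappa> ?u ?t" by (simp add: fraisse_sequence_def)
  then show ?thesis by blast
qed

end
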